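(* Let $\mathcal{H}$ be a complex Hilbert space and let $A,B,C\in\mathcal{B}(\mathcal{H})$. Then $$dw^2\begin{pmatrix} A & B\\ 0 & C\end{pmatrix}\leq\frac{9}{4}\max\left\{\|A\|^2,\|B\|^2,\|C\|^2\right\}+\frac{14+6\sqrt{5}}{4}\max\left\{\|A\|^4,\|B\|^4,\|C\|^4\right\}.$$
   Context: $\mathcal{B}(\mathcal{H})$ is the algebra of bounded linear operators on the complex Hilbert space $\mathcal{H}$, with operator norm $\|\cdot\|$. A $2\times2$ operator matrix acts on the Hilbert space direct sum $\mathcal{H}\oplus\mathcal{H}$ (norm $\|(x,y)\|^2=\|x\|^2+\|y\|^2$) in the usual way. For a bounded operator $T$ on a complex Hilbert space, the Davis-Wielandt radius is $dw(T)=\sup\{\sqrt{|\langle Tz,z\rangle|^2+\|Tz\|^4}: \|z\|=1\}$, and $dw^2(T)=(dw(T))^2$. *)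

theory Defs
  imports "HOL-Analysis.Analysis"
begin

class complex_vector = real_vector +
  fixes scaleC :: "complex \<Rightarrow> 'a \<Rightarrow> 'a"  (infixr "*\<^sub>C" 75)
  assumes scaleC_add_right: "a *\<^sub>C (x + y) = a *\<^sub>C x + a *\<^sub>C y"
    and scaleC_add_left: "(a + b) *\<^sub>C x = a *\<^sub>C x + b *\<^sub>C x"
    and scaleC_scaleC: "a *\<^sub>C b *\<^sub>C x = (a * b) *\<^sub>C x"
    and scaleR_scaleC: "r *\<^sub>R x = complex_of_real r *\<^sub>C x"

text \<open>The axiom \<open>1 *\<^sub>C x = x\<close> follows from \<open>scaleR_scaleC\<close>. The inner product is linear in its
  first argument.\<close>

class complex_inner = complex_vector + real_normed_vector +
  fixes cinner :: "'a \<Rightarrow> 'a \<Rightarrow> complex"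
  assumes cinner_commute: "cinner x y = cnj (cinner y x)"
    and cinner_add_left: "cinner (x + y) z = cinner x z + cinner y z"
    and cinner_scaleC_left: "cinner (a *\<^sub>C x) y = a * cinner x y"
    and cinner_ge_zero: "0 \<le> Re (cinner x x)"
    and cinner_eq_zero_iff: "cinner x x = 0 \<longleftrightarrow> x = 0"
    and norm_eq_sqrt_cinner: "norm x = sqrt (Re (cinner x x))"

class chilbert_space = complex_inner + complete_space

instantiation complex :: chilbert_space
begin

definition scaleC_complex :: "complex \<Rightarrow> complex \<Rightarrow> complex"
  where "scaleC_complex a x = a * x"

definition cinner_complex :: "complex \<Rightarrow> complex \<Rightarrow> complex"
  where "cinner_complex x y = x * cnj y"

instance
proof
  fix x y z a b :: complex and r :: real
  show "a *\<^sub>C (x + y) = a *\<^sub>C x + a *\<^sub>C y"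
    by (simp add: scaleC_complex_def distrib_left)
  show "(a + b) *\<^sub>C x = a *\<^sub>C x + b *\<^sub>C x"
    by (simp add: scaleC_complex_def distrib_right)
  show "a *\<^sub>C b *\<^sub>C x = (a * b) *\<^sub>C x"
    by (simp add: scaleC_complex_def)
  show "r *\<^sub>R x = complex_of_real r *\<^sub>C x"
    by (simp add: scaleC_complex_def scaleR_conv_of_real)
  show "cinner x y = cnj (cinner y x)"
    by (simp add: cinner_complex_def)
  show "cinner (x + y) z = cinner x z + cinner y z"
    by (simp add: cinner_complex_def distrib_right)
  show "cinner (a *\<^sub>C x) y = a * cinner x y"
    by (simp add: cinner_complex_def scaleC_complex_def)
  show "0 \<le> Re (cinner x x)"
    by (simp add: cinner_complex_def)
  show "cinner x x = 0 \<longleftrightarrow> x = 0"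
    by (simp add: cinner_complex_def)
  show "norm x = sqrt (Re (cinner x x))"
    by (simp add: cinner_complex_def cmod_def power2_eq_square)
qed

end

text \<open>The Hilbert space direct sum is the product type, whose library norm is
  \<open>norm (x, y) = sqrt ((norm x)\<^sup>2 + (norm y)\<^sup>2)\<close>.\<close>

instantiation prod :: (complex_vector, complex_vector) complex_vector
begin

definition scaleC_prod :: "complex \<Rightarrow> 'a \<times> 'b \<Rightarrow> 'a \<times> 'b"
  where "scaleC_prod a p = (a *\<^sub>C fst p, a *\<^sub>C snd p)"

instance
proof
  fix p q :: "'a \<times> 'b" and a b :: complex and r :: real
  show "a *\<^sub>C (p + q) = a *\<^sub>C p + a *\<^sub>C q"
    by (simp add: scaleC_prod_def scaleC_add_right)
  show "(a + b) *\<^sub>C p = a *\<^sub>C p + b *\<^sub>C p"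
    by (simp add: scaleC_prod_def scaleC_add_left)
  show "a *\<^sub>C b *\<^sub>C p = (a * b) *\<^sub>C p"
    by (simp add: scaleC_prod_def scaleC_scaleC)
  show "r *\<^sub>R p = complex_of_real r *\<^sub>C p"
    by (simp add: scaleC_prod_def scaleR_prod_def scaleR_scaleC)
qed

end

instantiation prod :: (complex_inner, complex_inner) complex_inner
begin

definition cinner_prod :: "'a \<times> 'b \<Rightarrow> 'a \<times> 'b \<Rightarrow> complex"
  where "cinner_prod p q = cinner (fst p) (fst q) + cinner (snd p) (snd q)"

instance
proof
  fix p q r :: "'a \<times> 'b" and a :: complex
  show "cinner p q = cnj (cinner q p)"
    unfolding cinner_prod_def complex_cnj_add
    by (intro arg_cong2[where f = "(+)"] cinner_commute)
  show "cinner (p + q) r = cinner p r + cinner q r"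
    by (simp add: cinner_prod_def cinner_add_left)
  show "cinner (a *\<^sub>C p) q = a * cinner p q"
    by (simp add: cinner_prod_def scaleC_prod_def cinner_scaleC_left distrib_left)
  show ge: "0 \<le> Re (cinner p p)"
    by (simp add: cinner_prod_def cinner_ge_zero)
  show norm_eq: "norm p = sqrt (Re (cinner p p))"
    by (simp add: norm_prod_def cinner_prod_def norm_eq_sqrt_cinner cinner_ge_zero)
  show "cinner p p = 0 \<longleftrightarrow> p = 0"
  proof
    assume "cinner p p = 0"
    then have "norm p = 0" by (simp add: norm_eq)
    then show "p = 0" by simp
  next
    assume "p = 0"
    moreover have "cinner (0 :: 'a) 0 = 0" "cinner (0 :: 'b) 0 = 0"
      by (simp_all add: cinner_eq_zero_iff)
    ultimately show "cinner p p = 0"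
      by (simp add: cinner_prod_def)
  qed
qed

end

instance prod :: (chilbert_space, chilbert_space) chilbert_space ..

definition bounded_clinear :: "('a :: complex_inner \<Rightarrow> 'b :: complex_inner) \<Rightarrow> bool"
  where "bounded_clinear T \<longleftrightarrow> bounded_linear T \<and> (\<forall>a x. T (a *\<^sub>C x) = a *\<^sub>C T x)"

definition op_matrix ::
  "('a \<Rightarrow> 'a) \<Rightarrow> ('a \<Rightarrow> 'a) \<Rightarrow> ('a \<Rightarrow> 'a) \<Rightarrow> ('a \<Rightarrow> 'a) \<Rightarrow> 'a \<times> 'a \<Rightarrow> 'a \<times> 'a :: chilbert_space"
  where "op_matrix A B C D = (\<lambda>(x, y). (A x + B y, C x + D y))"

text \<open>Davis-Wielandt radius. The supremum is taken in \<open>[0, \<infinity>)\<close>: inserting \<open>0\<close> changes nothing when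
  unit vectors exist, and gives the value \<open>0\<close> on the zero space, where \<open>Sup {}\<close> would be
  unspecified.\<close>

definition dw :: "('a :: chilbert_space \<Rightarrow> 'a) \<Rightarrow> real"
  where "dw T = Sup (insert 0 {sqrt ((cmod (cinner (T z) z))\<^sup>2 + norm (T z) ^ 4) | z. norm z = 1})"

end

theory Submission
  imports Defs
begin

text \<open>For a unit vector \<open>(x, y)\<close> put \<open>a = \<parallel>x\<parallel>\<close>, \<open>b = \<parallel>y\<parallel>\<close> and let \<open>m\<close> be the largest of the three
  operator norms. The numerical form is at most \<open>m (a\<^sup>2 + a b + b\<^sup>2) \<le> 3 m / 2\<close>, and
  \<open>\<parallel>T (x, y)\<parallel>\<^sup>2 \<le> m\<^sup>2 ((a + b)\<^sup>2 + b\<^sup>2)\<close>, a quadratic form whose largest eigenvalue is \<open>(3 + \<surd>5) / 2\<close>;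
  its square is \<open>(14 + 6 \<surd>5) / 4\<close>.\<close>

lemma cinner_self: "cinner x x = complex_of_real ((norm x)\<^sup>2)"
  for x :: "'a :: complex_inner"
proof (rule complex_eqI)
  show "Re (cinner x x) = Re (complex_of_real ((norm x)\<^sup>2))"
    by (simp add: norm_eq_sqrt_cinner cinner_ge_zero)
  \<comment> \<open>Conjugate symmetry with both arguments equal forces the value to be
    real.\<close>
  have "Im (cinner x x) = - Im (cinner x x)"
    by (metis cinner_commute cnj.sel(2))
  then show "Im (cinner x x) = Im (complex_of_real ((norm x)\<^sup>2))"
    by simp
qed

lemma cinner_add_right: "cinner x (y + z) = cinner x y + cinner x z"
  for x :: "'a :: complex_inner"
  by (metis cinner_add_left cinner_commute complex_cnj_add)

lemma cinner_scaleC_right: "cinner x (a *\<^sub>C y) = cnj a * cinner x y"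
  for x :: "'a :: complex_inner"
  by (metis cinner_commute cinner_scaleC_left complex_cnj_mult)

text \<open>Cauchy-Schwarz: the squared norm of a multiple of the part of \<open>x\<close>
  orthogonal to \<open>y\<close> is nonnegative.\<close>

lemma cmod_cinner_le_norm: "cmod (cinner x y) \<le> norm x * norm y"
  for x :: "'a :: complex_inner"
proof (cases "y = 0")
  case True
  have "cinner x (0 + 0) = cinner x 0 + cinner x 0"
    by (rule cinner_add_right)
  then show ?thesis
    using True by simp
next
  case False
  define n where "n = (norm y)\<^sup>2"
  define c where "c = cinner x y"
  \<comment> \<open>Dividing \<open>v\<close> by \<open>n\<close> gives \<open>x\<close> minus its
    projection onto \<open>y\<close>; clearing the denominator keeps the expansion
    polynomial.\<close>
  define v where "v = complex_of_real n *\<^sub>C x + (- c) *\<^sub>C y"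
  have n: "n > 0"
    using False by (simp add: n_def)
  have yx: "cinner y x = cnj c"
    unfolding c_def by (rule cinner_commute)
  have "complex_of_real ((norm v)\<^sup>2) = cinner v v"
    by (simp add: cinner_self)
  also have "\<dots> = complex_of_real n * (complex_of_real n * cinner x x) -
      complex_of_real n * (c * cnj c)
      - c * (complex_of_real n * cnj c) + c * cnj c * cinner y y"
    by (simp add: v_def cinner_add_left cinner_add_right cinner_scaleC_left cinner_scaleC_right
        yx flip: c_def) (simp add: algebra_simps)
  also have "\<dots> = complex_of_real (n * (n * (norm x)\<^sup>2 - (cmod c)\<^sup>2))"
    using complex_norm_square[of c] by (simp add: cinner_self algebra_simps flip: n_def)
  finally have "n * (n * (norm x)\<^sup>2 - (cmod c)\<^sup>2) = (norm v)\<^sup>2"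
    by (metis of_real_eq_iff)
  then have "0 \<le> n * (n * (norm x)\<^sup>2 - (cmod c)\<^sup>2)"
    by simp
  then have "(cmod c)\<^sup>2 \<le> (norm x * norm y)\<^sup>2"
    using n by (simp add: zero_le_mult_iff n_def power_mult_distrib mult.commute)
  then show ?thesis
    unfolding c_def by (rule power2_le_imp_le) simp
qed

text \<open>The constant is the larger eigenvalue of the matrix with rows (1, 1) and (1, 2).
  Subtracting the form from this multiple of \<open>a\<^sup>2 + b\<^sup>2\<close> therefore leaves a
  form of rank one, a positive multiple of a square that vanishes when \<open>b / a\<close> is the
  golden ratio.\<close>

lemma golden_quadratic_form_le:
  fixes a b :: real
  shows "(a + b)\<^sup>2 + b\<^sup>2 \<le> (3 + sqrt 5) / 2 * (a\<^sup>2 + b\<^sup>2)"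
proof -
  have s: "sqrt 5 * sqrt 5 = (5 :: real)"
    by simp
  have "0 \<le> (sqrt 5 - 1) / 2 * ((sqrt 5 + 1) / 2 * a - b)\<^sup>2"
    by (intro mult_nonneg_nonneg) auto
  also have "\<dots> = (3 + sqrt 5) / 2 * (a\<^sup>2 + b\<^sup>2) - ((a + b)\<^sup>2 + b\<^sup>2)"
    using s by (simp add: field_simps power2_eq_square)
  finally show ?thesis by simp
qed

lemma dw_power2_le:
  assumes "\<And>z. norm z = 1 \<Longrightarrow> (cmod (cinner (T z) z))\<^sup>2 + norm (T z) ^ 4 \<le> K" and "0 \<le> K"
  shows "(dw T)\<^sup>2 \<le> K"
proof -
  let ?S = "insert 0 {sqrt ((cmod (cinner (T z) z))\<^sup>2 + norm (T z) ^ 4) | z. norm z = 1}"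
  have bound: "s \<le> sqrt K" if "s \<in> ?S" for s
    using that assms by auto
  have "dw T \<le> sqrt K"
    unfolding dw_def by (rule cSup_least) (use bound in auto)
  \<comment> \<open>The inserted \<open>0\<close> lies below the supremum; this sign is needed to
    square the bound.\<close>
  moreover have "0 \<le> dw T"
    unfolding dw_def using bound by (intro cSup_upper bdd_aboveI) blast+
  ultimately have "(dw T)\<^sup>2 \<le> (sqrt K)\<^sup>2"
    by (rule power_mono)
  then show ?thesis
    using \<open>0 \<le> K\<close> by simp
qed

lemma norm_le_of_onorm_le:
  assumes "bounded_clinear T" and "onorm T \<le> m"
  shows "norm (T x) \<le> m * norm x"
proof -
  have "norm (T x) \<le> onorm T * norm x"
    using assms(1) by (simp add: bounded_clinear_def onorm)
  also have "\<dots> \<le> m * norm x"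
    using assms(2) by (rule mult_right_mono) simp
  finally show ?thesis .
qed

lemma upper_triangular_pointwise_bound:
  fixes A B C :: "'a :: chilbert_space \<Rightarrow> 'a"
  assumes A: "\<And>x. norm (A x) \<le> m * norm x"
    and B: "\<And>x. norm (B x) \<le> m * norm x"
    and C: "\<And>x. norm (C x) \<le> m * norm x"
    and "0 \<le> m" and z: "norm z = 1"
  defines "T \<equiv> op_matrix A B (\<lambda>_. 0) C"
  shows "(cmod (cinner (T z) z))\<^sup>2 + norm (T z) ^ 4 \<le> 9 / 4 * m\<^sup>2 + (14 + 6 * sqrt 5) / 4 * m ^ 4"
proof -
  obtain x y where zxy: "z = (x, y)"
    by fastforce
  let ?a = "norm x" and ?b = "norm y"
  have unit: "?a\<^sup>2 + ?b\<^sup>2 = 1"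
    using z by (simp add: zxy norm_prod_def)
  have Tz: "T z = (A x + B y, C y)"
    by (simp add: T_def op_matrix_def zxy)
  have u: "norm (A x + B y) \<le> m * (?a + ?b)"
    using norm_triangle_ineq[of "A x" "B y"] A[of x] B[of y] by (simp add: distrib_left)
  have "cmod (cinner (T z) z) \<le> cmod (cinner (A x + B y) x) + cmod (cinner (C y) y)"
    unfolding Tz by (simp add: zxy cinner_prod_def norm_triangle_ineq)
  also have "\<dots> \<le> norm (A x + B y) * ?a + norm (C y) * ?b"
    by (intro add_mono cmod_cinner_le_norm)
  also have "\<dots> \<le> m * (?a + ?b) * ?a + m * ?b * ?b"
    by (intro add_mono mult_right_mono u C) auto
  also have "\<dots> = m * (1 + ?a * ?b)"
    using unit by algebra
  \<comment> \<open>By AM-GM, twice the product of the two norms is at most the sum of their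
    squares, which is 1.\<close>
  also have "\<dots> \<le> m * (3 / 2)"
    using sum_squares_bound[of ?a ?b] unit \<open>0 \<le> m\<close> by (intro mult_left_mono) auto
  finally have "(cmod (cinner (T z) z))\<^sup>2 \<le> (m * (3 / 2))\<^sup>2"
    by (intro power_mono) auto
  then have form: "(cmod (cinner (T z) z))\<^sup>2 \<le> 9 / 4 * m\<^sup>2"
    by (simp add: power2_eq_square)
  have "(norm (T z))\<^sup>2 = (norm (A x + B y))\<^sup>2 + (norm (C y))\<^sup>2"
    by (simp add: Tz norm_prod_def)
  also have "\<dots> \<le> (m * (?a + ?b))\<^sup>2 + (m * ?b)\<^sup>2"
    by (intro add_mono power_mono u C) auto
  also have "\<dots> = m\<^sup>2 * ((?a + ?b)\<^sup>2 + ?b\<^sup>2)"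
    by algebra
  also have "\<dots> \<le> m\<^sup>2 * ((3 + sqrt 5) / 2)"
    using golden_quadratic_form_le[of ?a ?b] unit by (intro mult_left_mono) auto
  finally have "((norm (T z))\<^sup>2)\<^sup>2 \<le> (m\<^sup>2 * ((3 + sqrt 5) / 2))\<^sup>2"
    by (intro power_mono) auto
  \<comment> \<open>Here \<open>(3 + sqrt 5)\<^sup>2 = 14 + 6 * sqrt 5\<close>.\<close>
  moreover have "(m\<^sup>2 * ((3 + sqrt 5) / 2))\<^sup>2 = (14 + 6 * sqrt 5) / 4 * m ^ 4"
    by (simp add: power_mult_distrib power_divide power2_sum)
  ultimately show ?thesis
    using form by simp
qed

theorem theorem3p19:
  fixes A B C :: "'a :: chilbert_space \<Rightarrow> 'a"
  assumes "bounded_clinear A" and "bounded_clinear B" and "bounded_clinear C"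
  shows "(dw (op_matrix A B (\<lambda>_. 0) C))\<^sup>2
    \<le> 9 / 4 * Max {(onorm A)\<^sup>2, (onorm B)\<^sup>2, (onorm C)\<^sup>2}
      + (14 + 6 * sqrt 5) / 4 * Max {onorm A ^ 4, onorm B ^ 4, onorm C ^ 4}"
proof -
  define m where "m = Max {onorm A, onorm B, onorm C}"
  have le: "onorm A \<le> m" "onorm B \<le> m" "onorm C \<le> m"
    by (simp_all add: m_def)
  have "0 \<le> onorm A"
    using assms(1) by (simp add: bounded_clinear_def onorm_pos_le)
  then have m: "0 \<le> m"
    using le(1) by linarith
  \<comment> \<open>Since \<open>m\<close> is one of the three norms, \<open>m ^ k\<close> is one of
    the three powers, so \<open>Max\<close> need not be commuted with the power.\<close>
  have "m \<in> {onorm A, onorm B, onorm C}"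
    unfolding m_def by (rule Max_in) auto
  then have power: "m ^ k \<le> Max {onorm A ^ k, onorm B ^ k, onorm C ^ k}" for k
    by (intro Max_ge) auto
  have "(dw (op_matrix A B (\<lambda>_. 0) C))\<^sup>2 \<le> 9 / 4 * m\<^sup>2 + (14 + 6 * sqrt 5) / 4 * m ^ 4"
    using m assms le
    by (intro dw_power2_le upper_triangular_pointwise_bound norm_le_of_onorm_le) auto
  also have "\<dots> \<le> 9 / 4 * Max {(onorm A)\<^sup>2, (onorm B)\<^sup>2, (onorm C)\<^sup>2}
      + (14 + 6 * sqrt 5) / 4 * Max {onorm A ^ 4, onorm B ^ 4, onorm C ^ 4}"
    by (intro add_mono mult_left_mono power) auto
  finally show ?thesis .
qed

end
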